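(* Consider the following randomized algorithm for a $k$-CS-PIP instance normalized so that $c_j=1$ and $s_{ij}\le1$ for all $i,j$, with parameter $\alpha>0$ satisfying $\alpha k\ge1$. Let $x$ be an optimal solution of the natural LP relaxation. (1) Put each item $i$ into a set $\mathcal{S}$ independently with probability $x_i/(\alpha k)$. (2) Mark item $i$ for deletion if for some constraint $j$ with $s_{ij}>0$, either $\mathcal{S}$ contains some item $i'\neq i$ with $s_{i'j}>1/2$, or the sum of $s_{hj}$ over items $h\in\mathcal{S}$ with $0<s_{hj}\le 1/2$ exceeds $1$. (3) Output $\mathcal{S}'$, the set of items of $\mathcal{S}$ not marked. Then for every item $i\in[n]$ (with $x_i>0$), $\Pr[i\in\mathcal{S}'\mid i\in\mathcal{S}]\ge 1-\frac{2}{\alpha}$; equivalently, the probability that $i$ is deleted given $i\in\mathcal{S}$ is at most $2/\alpha$.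
   Context: $k$-CS-PIP: maximize $w^Tx$ subject to $Sx\le c$, $x\in\{0,1\}^n$, where $w\in\mathbb{R}^n_+$, $c\in\mathbb{R}^m_+$, $S=(s_{ij})\in\mathbb{R}^{m\times n}_+$ has at most $k$ nonzero entries per column. The natural LP relaxation replaces $x\in\{0,1\}^n$ by $x\in[0,1]^n$. *)

theory Defs
  imports "HOL-Probability.Probability"
begin

text \<open>
  Items are indexed by \<open>{1..n}\<close> and constraints by \<open>{1..m}\<close>; \<open>s i j\<close> is the coefficient
  of item \<open>i\<close> in constraint \<open>j\<close>, i.e. the entry of the \<open>m \<times> n\<close> constraint matrix in row
  \<open>j\<close> and column \<open>i\<close>. Values outside these index ranges are irrelevant.
\<close>

definition kcs_pip ::
  "nat \<Rightarrow> nat \<Rightarrow> nat \<Rightarrow> (nat \<Rightarrow> real) \<Rightarrow> (nat \<Rightarrow> nat \<Rightarrow> real) \<Rightarrow> (nat \<Rightarrow> real) \<Rightarrow> bool" where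
  "kcs_pip k m n w s c \<longleftrightarrow>
     (\<forall>i\<in>{1..n}. w i \<ge> 0) \<and>
     (\<forall>j\<in>{1..m}. c j \<ge> 0) \<and>
     (\<forall>i\<in>{1..n}. \<forall>j\<in>{1..m}. s i j \<ge> 0) \<and>
     (\<forall>i\<in>{1..n}. card {j\<in>{1..m}. s i j \<noteq> 0} \<le> k)"

definition normalized_pip ::
  "nat \<Rightarrow> nat \<Rightarrow> (nat \<Rightarrow> nat \<Rightarrow> real) \<Rightarrow> (nat \<Rightarrow> real) \<Rightarrow> bool" where
  "normalized_pip m n s c \<longleftrightarrow>
     (\<forall>j\<in>{1..m}. c j = 1) \<and> (\<forall>i\<in>{1..n}. \<forall>j\<in>{1..m}. s i j \<le> 1)"

definition lp_feasible ::
  "nat \<Rightarrow> nat \<Rightarrow> (nat \<Rightarrow> nat \<Rightarrow> real) \<Rightarrow> (nat \<Rightarrow> real) \<Rightarrow> (nat \<Rightarrow> real) \<Rightarrow> bool" where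
  "lp_feasible m n s c x \<longleftrightarrow>
     (\<forall>i\<in>{1..n}. 0 \<le> x i \<and> x i \<le> 1) \<and>
     (\<forall>j\<in>{1..m}. (\<Sum>i=1..n. s i j * x i) \<le> c j)"

definition lp_optimal ::
  "nat \<Rightarrow> nat \<Rightarrow> (nat \<Rightarrow> real) \<Rightarrow> (nat \<Rightarrow> nat \<Rightarrow> real) \<Rightarrow> (nat \<Rightarrow> real) \<Rightarrow> (nat \<Rightarrow> real) \<Rightarrow> bool" where
  "lp_optimal m n w s c x \<longleftrightarrow>
     is_arg_max (\<lambda>y. \<Sum>i=1..n. w i * y i) (lp_feasible m n s c) x"

definition independent_sample :: "nat \<Rightarrow> (nat \<Rightarrow> real) \<Rightarrow> nat set pmf" where
  "independent_sample n p =
     map_pmf (\<lambda>b. {i\<in>{1..n}. b i}) (Pi_pmf {1..n} False (\<lambda>i. bernoulli_pmf (p i)))"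

definition marked :: "nat \<Rightarrow> (nat \<Rightarrow> nat \<Rightarrow> real) \<Rightarrow> nat set \<Rightarrow> nat \<Rightarrow> bool" where
  "marked m s R i \<longleftrightarrow>
     (\<exists>j\<in>{1..m}. s i j > 0 \<and>
        ((\<exists>i'\<in>R. i' \<noteq> i \<and> s i' j > 1 / 2) \<or>
         (\<Sum>h\<in>{h\<in>R. 0 < s h j \<and> s h j \<le> 1 / 2}. s h j) > 1))"

text \<open>The algorithm yields the joint distribution of the sampled set and the output set.\<close>

definition pip_rounding ::
  "nat \<Rightarrow> nat \<Rightarrow> nat \<Rightarrow> (nat \<Rightarrow> nat \<Rightarrow> real) \<Rightarrow> real \<Rightarrow> (nat \<Rightarrow> real) \<Rightarrow> (nat set \<times> nat set) pmf" where
  "pip_rounding k m n s \<alpha> x =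
     map_pmf (\<lambda>R. (R, {i\<in>R. \<not> marked m s R i}))
       (independent_sample n (\<lambda>i. x i / (\<alpha> * real k)))"

end

theory Submission
  imports Defs
begin

text \<open>
  If item \<open>i\<close> of the sample \<open>R\<close> is marked because of constraint \<open>j\<close>, then the items of
  \<open>R - {i}\<close> have total weight at least \<open>1/2\<close> in constraint \<open>j\<close>: either one of them alone weighs more
  than \<open>1/2\<close>, or the small items weigh more than \<open>1\<close>, of which \<open>i\<close> contributes at most \<open>1/2\<close>.
  So the large and the small case are covered by one application of Markov's inequality to the weight
  of \<open>R - {i}\<close>, taken in all of the at most \<open>k\<close> constraints of \<open>i\<close> together. Since \<open>R - {i}\<close> is
  independent of the event \<open>i \<in> R\<close>, its expected weight in a constraint is at most \<open>1 / (\<alpha> k)\<close> by LP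
  feasibility, also conditionally on that event.
\<close>

lemma set_pmf_independent_sample: "set_pmf (independent_sample n p) \<subseteq> Pow {1..n}"
  by (auto simp: independent_sample_def)

text \<open>In terms of the coin flips, the event only forces the coordinates in \<open>T\<close> to
  be \<open>True\<close>, so it is a product event. It is used for \<open>{i}\<close> and for pairs
  \<open>{i, h}\<close>.\<close>

lemma prob_independent_sample_superset:
  assumes T: "T \<subseteq> {1..n}" and p: "\<And>h. h \<in> {1..n} \<Longrightarrow> 0 \<le> p h \<and> p h \<le> 1"
  shows "measure_pmf.prob (independent_sample n p) {R. T \<subseteq> R} = (\<Prod>h\<in>T. p h)"
proof -
  let ?M = "Pi_pmf {1..n} False (\<lambda>i. bernoulli_pmf (p i))"
  have "(\<lambda>b. {i\<in>{1..n}. b i}) -` {R. T \<subseteq> R} = Pi {1..n} (\<lambda>h. if h \<in> T then {True} else UNIV)"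
    using T by (auto simp: Pi_def split: if_splits)
  then have "measure_pmf.prob (independent_sample n p) {R. T \<subseteq> R}
      = measure_pmf.prob ?M (Pi {1..n} (\<lambda>h. if h \<in> T then {True} else UNIV))"
    by (simp add: independent_sample_def)
  also have "\<dots> = (\<Prod>h\<in>{1..n}. measure_pmf.prob (bernoulli_pmf (p h)) (if h \<in> T then {True} else UNIV))"
    by (rule measure_Pi_pmf_Pi) simp
  also have "\<dots> = (\<Prod>h\<in>{1..n}. if h \<in> T then p h else 1)"
    using p by (intro prod.cong) (auto simp: measure_pmf_single)
  also have "\<dots> = (\<Prod>h\<in>T. p h)"
    using T by (simp add: prod.If_cases Int_absorb1)
  finally show ?thesis .
qed

text \<open>On \<open>i \<in> R\<close>, the indicator of the event is at most the sum itself. For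
  \<open>h \<noteq> i\<close>, the pair \<open>{i, h}\<close> is sampled with probability
  \<open>p i * p h\<close>, so \<open>p i\<close> factors out of the expectation. Working with joint
  probabilities avoids dividing by \<open>p i\<close>.\<close>

lemma independent_sample_Markov:
  assumes i: "i \<in> {1..n}" and p: "\<And>h. h \<in> {1..n} \<Longrightarrow> 0 \<le> p h \<and> p h \<le> 1"
    and g: "\<And>h. h \<in> {1..n} \<Longrightarrow> 0 \<le> g h"
  shows "measure_pmf.prob (independent_sample n p) {R. i \<in> R \<and> 1 \<le> (\<Sum>h\<in>R - {i}. g h)}
      \<le> p i * (\<Sum>h\<in>{1..n} - {i}. p h * g h)"
proof -
  let ?M = "independent_sample n p"
  let ?E = "{R. i \<in> R \<and> 1 \<le> (\<Sum>h\<in>R - {i}. g h)}"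
  have "finite (set_pmf ?M)"
    using set_pmf_independent_sample by (rule finite_subset) simp
  then have int: "integrable ?M f" for f :: "nat set \<Rightarrow> real"
    by (rule integrable_measure_pmf_finite)
  have "measure_pmf.prob ?M ?E = measure_pmf.expectation ?M (indicator ?E)"
    by simp
  also have "\<dots> \<le> measure_pmf.expectation ?M (\<lambda>R. \<Sum>h\<in>{1..n} - {i}. g h * indicator {R. {i, h} \<subseteq> R} R)"
  proof (intro integral_mono_AE int, unfold AE_measure_pmf_iff, intro ballI)
    fix R assume "R \<in> set_pmf ?M"
    then have R: "R \<subseteq> {1..n}" using set_pmf_independent_sample by blast
    have "indicator ?E R \<le> (if i \<in> R then \<Sum>h\<in>R - {i}. g h else 0)"
      using g R by (auto simp: indicator_def intro!: sum_nonneg)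
    \<comment> \<open>The range of summation no longer depends on \<open>R\<close>, so expectation
      and sum can be exchanged.\<close>
    also have "\<dots> = (\<Sum>h\<in>{1..n} - {i}. if {i, h} \<subseteq> R then g h else 0)"
      using R by (auto intro!: sum.mono_neutral_cong_left split: if_splits)
    also have "\<dots> = (\<Sum>h\<in>{1..n} - {i}. g h * indicator {R. {i, h} \<subseteq> R} R)"
      by (intro sum.cong) (auto simp: indicator_def)
    finally show "indicator ?E R \<le> (\<Sum>h\<in>{1..n} - {i}. g h * indicator {R. {i, h} \<subseteq> R} R)" .
  qed
  also have "\<dots> = (\<Sum>h\<in>{1..n} - {i}. g h * measure_pmf.prob ?M {R. {i, h} \<subseteq> R})"
    by (subst Bochner_Integration.integral_sum) (auto simp: int simp del: insert_subset)
  also have "\<dots> = (\<Sum>h\<in>{1..n} - {i}. g h * (p i * p h))"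
  proof (rule sum.cong)
    fix h assume h: "h \<in> {1..n} - {i}"
    then have "measure_pmf.prob ?M {R. {i, h} \<subseteq> R} = (\<Prod>h\<in>{i, h}. p h)"
      using i p by (intro prob_independent_sample_superset) auto
    with h show "g h * measure_pmf.prob ?M {R. {i, h} \<subseteq> R} = g h * (p i * p h)"
      by (simp del: insert_subset)
  qed simp
  also have "\<dots> = p i * (\<Sum>h\<in>{1..n} - {i}. p h * g h)"
    by (simp add: sum_distrib_left mult_ac)
  finally show ?thesis .
qed

lemma marked_imp_weight_ge:
  assumes "marked m s R i" and fin: "finite R" and s: "\<And>h j. h \<in> R \<Longrightarrow> j \<in> {1..m} \<Longrightarrow> 0 \<le> s h j"
  obtains j where "j \<in> {1..m}" "s i j > 0" "1 / 2 \<le> (\<Sum>h\<in>R - {i}. s h j)"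
proof -
  from \<open>marked m s R i\<close> obtain j where j: "j \<in> {1..m}" "s i j > 0"
    and disj: "(\<exists>i'\<in>R. i' \<noteq> i \<and> s i' j > 1 / 2) \<or>
         (\<Sum>h\<in>{h\<in>R. 0 < s h j \<and> s h j \<le> 1 / 2}. s h j) > 1"
    unfolding marked_def by blast
  from disj have "1 / 2 \<le> (\<Sum>h\<in>R - {i}. s h j)"
  proof
    assume "\<exists>i'\<in>R. i' \<noteq> i \<and> s i' j > 1 / 2"
    then obtain i' where i': "i' \<in> R - {i}" "s i' j > 1 / 2" by blast
    have "s i' j \<le> (\<Sum>h\<in>R - {i}. s h j)"
      using i' fin s j by (intro member_le_sum) auto
    with i' show ?thesis by simp
  next
    let ?L = "{h\<in>R. 0 < s h j \<and> s h j \<le> 1 / 2}"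
    assume "(\<Sum>h\<in>?L. s h j) > 1"
    moreover have "(\<Sum>h\<in>?L. s h j) \<le> 1 / 2 + (\<Sum>h\<in>?L - {i}. s h j)"
    proof (cases "i \<in> ?L")
      case True
      then have "(\<Sum>h\<in>?L. s h j) = s i j + (\<Sum>h\<in>?L - {i}. s h j)"
        using fin by (intro sum.remove) auto
      with True show ?thesis by simp
    qed simp
    moreover have "(\<Sum>h\<in>?L - {i}. s h j) \<le> (\<Sum>h\<in>R - {i}. s h j)"
      using fin s j by (intro sum_mono2) auto
    ultimately show ?thesis by simp
  qed
  with j that show thesis by blast
qed

lemma prob_sampled_and_marked_le:
  assumes pip: "kcs_pip k m n w s c" and norm: "normalized_pip m n s c"
    and \<alpha>: "\<alpha> > 0" "\<alpha> * real k \<ge> 1" and feas: "lp_feasible m n s c x" and i: "i \<in> {1..n}"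
  shows "measure_pmf.prob (independent_sample n (\<lambda>i. x i / (\<alpha> * real k))) {R. i \<in> R \<and> marked m s R i}
      \<le> x i / (\<alpha> * real k) * (2 / \<alpha>)"
proof -
  define p where "p = (\<lambda>i. x i / (\<alpha> * real k))"
  define J where "J = {j\<in>{1..m}. s i j \<noteq> 0}"
  \<comment> \<open>The factor 2 rescales the threshold \<open>1/2\<close> to the threshold 1 of the
    Markov lemma. Summing over \<open>J\<close> replaces a union bound over the constraints of
    \<open>i\<close>.\<close>
  define g where "g = (\<lambda>h. \<Sum>j\<in>J. 2 * s h j)"
  let ?M = "independent_sample n p"
  \<comment> \<open>The case \<open>k = 0\<close> would contradict
    \<open>\<alpha> * real k \<ge> 1\<close>.\<close>
  have k: "real k > 0" using \<alpha> by (cases k) auto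
  have s: "0 \<le> s h j" if "h \<in> {1..n}" "j \<in> {1..m}" for h j
    using pip that by (auto simp: kcs_pip_def)
  have cardJ: "card J \<le> k" using pip i by (auto simp: kcs_pip_def J_def)
  have J: "finite J" "J \<subseteq> {1..m}" by (auto simp: J_def)
  have x: "0 \<le> x h \<and> x h \<le> 1" if "h \<in> {1..n}" for h
    using feas that by (auto simp: lp_feasible_def)
  have row: "(\<Sum>h=1..n. s h j * x h) \<le> 1" if "j \<in> J" for j
    using feas norm that J by (auto simp: lp_feasible_def normalized_pip_def)
  have p: "0 \<le> p h \<and> p h \<le> 1" if "h \<in> {1..n}" for h
    using x[OF that] \<alpha> by (simp add: p_def)
  have g: "0 \<le> g h" if "h \<in> {1..n}" for h
    using s that J by (auto simp: g_def intro!: sum_nonneg)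
  have "measure_pmf.prob ?M {R. i \<in> R \<and> marked m s R i}
      \<le> measure_pmf.prob ?M {R. i \<in> R \<and> 1 \<le> (\<Sum>h\<in>R - {i}. g h)}"
  \<comment> \<open>The inclusion of events is checked only on the support, where \<open>R\<close>
    is finite and its coefficients are nonnegative.\<close>
  proof (rule measure_pmf.finite_measure_mono_AE, unfold AE_measure_pmf_iff, intro ballI impI)
    fix R assume "R \<in> set_pmf ?M" and mk: "R \<in> {R. i \<in> R \<and> marked m s R i}"
    then have R: "R \<subseteq> {1..n}" using set_pmf_independent_sample by blast
    then have fin: "finite R" by (rule finite_subset) simp
    obtain j where j: "j \<in> {1..m}" "s i j > 0" "1 / 2 \<le> (\<Sum>h\<in>R - {i}. s h j)"
      by (rule marked_imp_weight_ge[of m s R i]) (use mk fin s R in auto)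
    have "1 \<le> 2 * (\<Sum>h\<in>R - {i}. s h j)"
      using j by simp
    also have "\<dots> = (\<Sum>h\<in>R - {i}. 2 * s h j)"
      by (rule sum_distrib_left)
    also have "\<dots> \<le> (\<Sum>h\<in>R - {i}. g h)"
      unfolding g_def
    proof (intro sum_mono member_le_sum)
      show "j \<in> J" using j by (simp add: J_def)
    qed (use R s J in \<open>auto simp: subset_iff\<close>)
    finally show "R \<in> {R. i \<in> R \<and> 1 \<le> (\<Sum>h\<in>R - {i}. g h)}"
      using mk by simp
  qed simp
  also have "\<dots> \<le> p i * (\<Sum>h\<in>{1..n} - {i}. p h * g h)"
    using i p g by (rule independent_sample_Markov)
  also have "\<dots> \<le> p i * (2 / \<alpha>)"
  proof (rule mult_left_mono)
    \<comment> \<open>Adding the nonnegative term for \<open>i\<close> completes the row sums, so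
      that after exchanging the sums each inner one is bounded by its LP constraint. Then
      \<open>card J \<le> k\<close> cancels the \<open>k\<close> of the sampling rate.\<close>
    have "(\<Sum>h\<in>{1..n} - {i}. p h * g h) \<le> (\<Sum>h=1..n. p h * g h)"
      using p g by (intro sum_mono2) auto
    also have "\<dots> = (\<Sum>h=1..n. \<Sum>j\<in>J. 2 / (\<alpha> * real k) * (s h j * x h))"
      by (simp add: p_def g_def sum_distrib_left mult_ac)
    also have "\<dots> = 2 / (\<alpha> * real k) * (\<Sum>j\<in>J. \<Sum>h=1..n. s h j * x h)"
      by (subst sum.swap) (simp add: sum_distrib_left)
    also have "\<dots> \<le> 2 / (\<alpha> * real k) * (\<Sum>j\<in>J. 1)"
      using row \<alpha> by (intro mult_left_mono sum_mono) auto
    also have "\<dots> \<le> 2 / (\<alpha> * real k) * real k"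
      using cardJ \<alpha> by (intro mult_left_mono) auto
    also have "\<dots> = 2 / \<alpha>"
      using k by simp
    finally show "(\<Sum>h\<in>{1..n} - {i}. p h * g h) \<le> 2 / \<alpha>" .
  qed (use p i in simp)
  finally show ?thesis by (simp add: p_def)
qed

theorem theorem1:
  fixes k m n :: nat
    and w c x :: "nat \<Rightarrow> real"
    and s :: "nat \<Rightarrow> nat \<Rightarrow> real"
    and \<alpha> :: real
    and i :: nat
  assumes "kcs_pip k m n w s c"
    and "normalized_pip m n s c"
    and "\<alpha> > 0"
    and "\<alpha> * real k \<ge> 1"
    and "lp_optimal m n w s c x"
    and "i \<in> {1..n}"
    and "x i > 0"
  shows "\<P>((R, R') in measure_pmf (pip_rounding k m n s \<alpha> x). i \<in> R' \<bar> i \<in> R) \<ge> 1 - 2 / \<alpha> \<and>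
         \<P>((R, R') in measure_pmf (pip_rounding k m n s \<alpha> x). i \<notin> R' \<bar> i \<in> R) \<le> 2 / \<alpha>"
proof -
  let ?p = "\<lambda>i. x i / (\<alpha> * real k)"
  let ?M = "independent_sample n ?p"
  let ?A = "{R. i \<in> R \<and> marked m s R i}" and ?B = "{R. i \<in> R \<and> \<not> marked m s R i}"
  have feas: "lp_feasible m n s c x"
    using assms(5) by (simp add: lp_optimal_def is_arg_max_def)
  have p: "0 \<le> ?p h \<and> ?p h \<le> 1" if "h \<in> {1..n}" for h
  proof -
    have "0 \<le> x h \<and> x h \<le> 1"
      using feas that by (auto simp: lp_feasible_def)
    then show ?thesis using assms(4) by simp
  qed
  have pos: "?p i > 0" using assms(4,7) by simp
  have Q: "measure_pmf.prob ?M {R. i \<in> R} = ?p i"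
    using prob_independent_sample_superset[of "{i}" n ?p] p assms(6) by simp
  have A: "measure_pmf.prob ?M ?A \<le> ?p i * (2 / \<alpha>)"
    using prob_sampled_and_marked_le[OF assms(1-4) feas assms(6)] .
  \<comment> \<open>Given \<open>i \<in> R\<close>, the item is deleted exactly on \<open>?A\<close>
    and kept exactly on \<open>?B\<close>, so the two conditional probabilities are complementary
    and one bound gives both claims.\<close>
  have "measure_pmf.prob ?M {R. i \<in> R} = measure_pmf.prob ?M (?A \<union> ?B)"
    by (rule arg_cong[where f = "measure_pmf.prob ?M"]) auto
  also have "\<dots> = measure_pmf.prob ?M ?A + measure_pmf.prob ?M ?B"
    by (rule measure_pmf.finite_measure_Union) auto
  finally have B: "measure_pmf.prob ?M ?B = ?p i - measure_pmf.prob ?M ?A"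
    using Q by simp
  have "\<P>((R, R') in measure_pmf (pip_rounding k m n s \<alpha> x). i \<notin> R' \<bar> i \<in> R) = measure_pmf.prob ?M ?A / ?p i"
    unfolding Q[symmetric]
    by (auto simp: cond_prob_def pip_rounding_def vimage_def intro!: arg_cong2[where f = "(/)"]
        arg_cong[where f = "measure_pmf.prob ?M"])
  moreover have "\<P>((R, R') in measure_pmf (pip_rounding k m n s \<alpha> x). i \<in> R' \<bar> i \<in> R) = measure_pmf.prob ?M ?B / ?p i"
    unfolding Q[symmetric]
    by (auto simp: cond_prob_def pip_rounding_def vimage_def intro!: arg_cong2[where f = "(/)"]
        arg_cong[where f = "measure_pmf.prob ?M"])
  moreover have "measure_pmf.prob ?M ?A / ?p i \<le> 2 / \<alpha>"
    using A pos by (subst pos_divide_le_eq) (simp_all only: mult.commute)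
  moreover have "measure_pmf.prob ?M ?B / ?p i = 1 - measure_pmf.prob ?M ?A / ?p i"
    unfolding B diff_divide_distrib divide_self[OF less_imp_neq[OF pos, symmetric]] ..
  ultimately show ?thesis by linarith
qed

end
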